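(* Let $n_1,\dots,n_k$ be positive integers with $\sum_{i=1}^k n_i=n$, let $Q_i\in\mathbb{R}^{n_i\times n_i}$ be orthogonal for each $i$, let $Q=\bigoplus_{i=1}^kQ_i$ and $S=\operatorname{sgn}(Q)$. Let $B\in\mathbb{R}^{n\times n}$ be a block matrix with $(i,j)$-block $B_{ij}\in\mathbb{R}^{n_i\times n_j}$ (conformal with $Q$), and let $R=\operatorname{sgn}(B)$. If $B_{ij}=-Q_iB_{ji}^TQ_j$ for all $i,j$, and $X=O$ is the only symmetric $n\times n$ matrix satisfying $(XQ)\circ S_{\vec R}=O$, then $S_{\vec R}$ allows orthogonality.
   Context: All matrices are real; $\circ$ is the Hadamard product; $\bigoplus$ denotes direct sum (block diagonal). A sign pattern is a $(0,1,-1)$-matrix; $\operatorname{sgn}$ is applied entrywise. An $n\times n$ sign pattern $T$ allows orthogonality if there is a real orthogonal matrix with sign pattern $T$. For sign patterns $S=[s_{ij}]$, $R=[r_{ij}]$ of the same size, $S_{\vec R}$ is the sign pattern with $(i,j)$-entry $s_{ij}$ if $s_{ij}\neq0$ and $r_{ij}$ otherwise. *)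

theory Defs
  imports Complex_Main "Jordan_Normal_Form.Matrix"
begin

text \<open>The library predicate \<^const>\<open>orthogonal_mat\<close> only asks for pairwise orthogonal
  nonzero columns, without normalisation, hence the separate definition.\<close>

definition real_orthogonal_mat :: "real mat \<Rightarrow> bool" where
  "real_orthogonal_mat A \<longleftrightarrow> square_mat A \<and> transpose_mat A * A = 1\<^sub>m (dim_row A)"

definition hadamard_prod :: "real mat \<Rightarrow> real mat \<Rightarrow> real mat" where
  "hadamard_prod A B = mat (dim_row A) (dim_col A) (\<lambda>(i, j). A $$ (i, j) * B $$ (i, j))"

text \<open>Sign patterns are represented as real matrices with entries in \<open>{0, 1, -1}\<close>.\<close>

definition sgn_mat :: "real mat \<Rightarrow> real mat" where
  "sgn_mat A = map_mat sgn A"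

definition allows_orthogonality :: "real mat \<Rightarrow> bool" where
  "allows_orthogonality T \<longleftrightarrow> (\<exists>A. real_orthogonal_mat A \<and> sgn_mat A = T)"

text \<open>\<open>superpattern_dir S R\<close> is \<open>S\<close> with its zero entries replaced by those of \<open>R\<close>,
  usually written $S_{\vec R}$.\<close>

definition superpattern_dir :: "real mat \<Rightarrow> real mat \<Rightarrow> real mat" where
  "superpattern_dir S R = mat (dim_row S) (dim_col S)
     (\<lambda>(i, j). if S $$ (i, j) \<noteq> 0 then S $$ (i, j) else R $$ (i, j))"

text \<open>Block sizes are \<open>ns 0, ns 1, \<dots>\<close>; block indices start at \<open>0\<close>.\<close>

definition mat_block :: "(nat \<Rightarrow> nat) \<Rightarrow> 'a mat \<Rightarrow> nat \<Rightarrow> nat \<Rightarrow> 'a mat" where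
  "mat_block ns B i j = mat (ns i) (ns j)
     (\<lambda>(a, b). B $$ ((\<Sum>l<i. ns l) + a, (\<Sum>l<j. ns l) + b))"

end

theory Submission
  imports Defs "Jordan_Normal_Form.Determinant" "HOL-Analysis.L2_Norm"
    "HOL-Analysis.Function_Topology" "HOL-Analysis.Convex"
begin

text \<open>The block condition says \<open>B Q\<^sup>T + Q B\<^sup>T = 0\<close>, so \<open>B\<close> is tangent to the orthogonal group at \<open>Q\<close>,
  and \<open>C = Q + t B\<close> satisfies \<open>C C\<^sup>T - I = t\<^sup>2 B B\<^sup>T\<close>. Instead of an implicit function theorem,
  minimise the exact penalty \<open>\<parallel>A A\<^sup>T - I\<parallel> + \<delta> \<parallel>A - C\<parallel>\<close> (Frobenius norms) over all \<open>A\<close> supported on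
  the support \<open>M\<close> of the superpattern. Comparison with \<open>C\<close> gives \<open>\<parallel>A - C\<parallel> = O(t\<^sup>2)\<close>, which fixes
  all the signs of \<open>A\<close> for small \<open>t > 0\<close>. If \<open>X = A A\<^sup>T - I\<close> were nonzero, stationarity would give
  \<open>2 \<parallel>(X A)\<^sub>M\<parallel> \<le> \<delta> \<parallel>X\<parallel>\<close>; but the hypothesis on symmetric matrices and compactness give
  \<open>\<parallel>(X Q)\<^sub>M\<parallel> \<ge> \<delta> \<parallel>X\<parallel>\<close> for some \<open>\<delta> > 0\<close>, a contradiction as \<open>A\<close> is close to \<open>Q\<close>.\<close>

section \<open>Matrices as functions on index pairs, with Frobenius norms\<close>

abbreviation frob :: "nat \<Rightarrow> (nat \<times> nat \<Rightarrow> real) \<Rightarrow> real" where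
  "frob n A \<equiv> L2_set A ({..<n} \<times> {..<n})"

text \<open>The entries of \<open>A A^T - I\<close>. A matrix is a total function on index pairs, so
  that the product topology on functions is available; \<open>frob n\<close> sees only the values on
  the index square.\<close>

definition gram_defect :: "nat \<Rightarrow> (nat \<times> nat \<Rightarrow> real) \<Rightarrow> nat \<times> nat \<Rightarrow> real" where
  "gram_defect n A = (\<lambda>(i, j). (\<Sum>l<n. A (i, l) * A (j, l)) - of_bool (i = j))"

text \<open>For \<open>X = gram_defect n A\<close> this is, up to the factor 4, the gradient of the
  squared Frobenius norm of the Gram defect at \<open>A\<close>, projected to the matrices supported
  on \<open>M\<close>.\<close>

definition masked_mult ::
  "nat \<Rightarrow> (nat \<times> nat) set \<Rightarrow> (nat \<times> nat \<Rightarrow> real) \<Rightarrow> (nat \<times> nat \<Rightarrow> real) \<Rightarrow> nat \<times> nat \<Rightarrow> real" where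
  "masked_mult n M X A = (\<lambda>(i, j). if (i, j) \<in> M then \<Sum>l<n. X (i, l) * A (l, j) else 0)"

text \<open>Tychonoff's theorem for a product of intervals. Taking \<open>b i = 0\<close> freezes a
  coordinate at zero, which cuts the function space down to finitely many free entries in the uses
  below.\<close>

lemma compact_abs_le_box: "compact {x :: 'a \<Rightarrow> real. \<forall>i. \<bar>x i\<bar> \<le> b i}"
proof -
  have "compactin (product_topology (\<lambda>i. euclidean) UNIV) (PiE UNIV (\<lambda>i. {- b i..b i}))"
    by (simp add: compactin_PiE)
  moreover have "PiE UNIV (\<lambda>i. {- b i..b i}) = {x. \<forall>i. \<bar>x i\<bar> \<le> b i}"
    by (auto simp: PiE_def Pi_def abs_le_iff minus_le_iff)
  ultimately show ?thesis
    by (simp add: euclidean_product_topology)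
qed

lemma continuous_on_coordinate [continuous_intros]:
  "continuous_on S (\<lambda>x. x i :: 'b :: topological_space)"
  by (rule continuous_on_subset[OF continuous_on_product_coordinates]) simp

lemma continuous_on_L2_set [continuous_intros]:
  assumes "\<And>p. p \<in> P \<Longrightarrow> continuous_on S (\<lambda>x. f x p)"
  shows "continuous_on S (\<lambda>x. L2_set (f x) P)"
  unfolding L2_set_def by (intro continuous_intros assms)

lemma L2_set_power2: "(L2_set f P)\<^sup>2 = (\<Sum>p\<in>P. (f p)\<^sup>2)"
  by (simp add: L2_set_def sum_nonneg)

lemma abs_le_L2_set: "finite P \<Longrightarrow> p \<in> P \<Longrightarrow> \<bar>f p\<bar> \<le> L2_set f P"
  using member_le_L2_set[of P p "\<lambda>p. \<bar>f p\<bar>"] by (simp add: L2_set_def)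

lemma L2_set_cmult: "L2_set (\<lambda>p. c * f p) P = \<bar>c\<bar> * L2_set f P"
  by (simp add: L2_set_def power_mult_distrib sum_distrib_left[symmetric] real_sqrt_mult)

text \<open>Cauchy-Schwarz bounds each entry of the full product, and masking only drops squares
  from the sum.\<close>

lemma frob_masked_mult_le: "frob n (masked_mult n M X A) \<le> frob n X * frob n A"
proof (rule power2_le_imp_le)
  have "(frob n (masked_mult n M X A))\<^sup>2
      \<le> (\<Sum>i<n. \<Sum>j<n. (\<Sum>l<n. X (i, l) * A (l, j))\<^sup>2)"
    unfolding L2_set_power2 sum.cartesian_product
    by (intro sum_mono) (auto simp: masked_mult_def)
  also have "\<dots> \<le> (\<Sum>i<n. \<Sum>j<n. (\<Sum>l<n. (X (i, l))\<^sup>2) * (\<Sum>l<n. (A (l, j))\<^sup>2))"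
    by (intro sum_mono Cauchy_Schwarz_ineq_sum)
  also have "\<dots> = (\<Sum>i<n. \<Sum>l<n. (X (i, l))\<^sup>2) * (\<Sum>j<n. \<Sum>l<n. (A (l, j))\<^sup>2)"
    by (simp add: sum_product)
  also have "(\<Sum>j<n. \<Sum>l<n. (A (l, j))\<^sup>2) = (\<Sum>l<n. \<Sum>j<n. (A (l, j))\<^sup>2)"
    by (rule sum.swap)
  also have "(\<Sum>i<n. \<Sum>l<n. (X (i, l))\<^sup>2) * \<dots> = (frob n X * frob n A)\<^sup>2"
    by (simp add: power_mult_distrib L2_set_power2 sum.cartesian_product)
  finally show "(frob n (masked_mult n M X A))\<^sup>2 \<le> (frob n X * frob n A)\<^sup>2" .
qed simp

section \<open>A uniform lower bound on symmetric matrices\<close>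

text \<open>The norm of the masked product is continuous and homogeneous in \<open>X\<close>, so its
  minimum over the compact unit sphere of symmetric matrices serves as \<open>\<delta>\<close>;
  injectivity makes that minimum positive.\<close>

lemma masked_mult_lower_bound:
  assumes inj: "\<And>X. \<lbrakk>\<And>p. p \<notin> {..<n} \<times> {..<n} \<Longrightarrow> X p = 0; \<And>i j. X (i, j) = X (j, i);
                  \<And>p. p \<in> {..<n} \<times> {..<n} \<Longrightarrow> masked_mult n M X A p = 0\<rbrakk> \<Longrightarrow> \<forall>p. X p = 0"
  obtains \<delta> where "\<delta> > 0"
    and "\<And>X. (\<And>i j. i < n \<Longrightarrow> j < n \<Longrightarrow> X (i, j) = X (j, i)) \<Longrightarrow>
           \<delta> * frob n X \<le> frob n (masked_mult n M X A)"
proof -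
  let ?P = "{..<n} \<times> {..<n}"
  let ?f = "\<lambda>X. frob n (masked_mult n M X A)"
  \<comment> \<open>The unit sphere of symmetric matrices. Intersecting with the box makes it
    compact: a norm of 1 already forces entries of modulus at most 1, and outside the square they
    are fixed at 0.\<close>
  define K where "K = {X. \<forall>p. \<bar>X p\<bar> \<le> (if p \<in> ?P then 1 else 0)}
      \<inter> ({X. \<forall>i j. X (i, j) = X (j, i)} \<inter> {X. frob n X = 1})"
  have cont: "continuous_on UNIV ?f"
  proof (intro continuous_intros)
    show "continuous_on UNIV (\<lambda>X. masked_mult n M X A p)" for p
      by (cases p; cases "p \<in> M") (auto simp: masked_mult_def intro!: continuous_intros)
  qed
  have "closed {X :: nat \<times> nat \<Rightarrow> real. \<forall>i j. X (i, j) = X (j, i)}"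
    by (intro closed_Collect_all closed_Collect_eq continuous_intros)
  moreover have "closed {X. frob n X = 1}"
    by (intro closed_Collect_eq continuous_intros)
  ultimately have "compact K"
    unfolding K_def by (intro compact_Int_closed closed_Int compact_abs_le_box)
  \<comment> \<open>Scaling is combined with truncation to the index square, so \<open>X\<close> may
    be arbitrary outside the square although members of \<open>K\<close> vanish there.\<close>
  have normalise: "\<exists>Y\<in>K. ?f X = frob n X * ?f Y"
    if sym: "\<And>i j. i < n \<Longrightarrow> j < n \<Longrightarrow> X (i, j) = X (j, i)" and pos: "frob n X > 0" for X
  proof
    define Y where "Y = (\<lambda>p. if p \<in> ?P then inverse (frob n X) * X p else 0)"
    have "frob n Y = frob n (\<lambda>p. inverse (frob n X) * X p)"
      by (intro L2_set_cong) (auto simp: Y_def)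
    also have "\<dots> = 1"
      using pos by (simp add: L2_set_cmult)
    finally have "frob n Y = 1" .
    moreover have "\<bar>Y p\<bar> \<le> 1" if "p \<in> ?P" for p
      using abs_le_L2_set[OF _ that, of Y] \<open>frob n Y = 1\<close> by simp
    moreover have "Y p = 0" if "p \<notin> ?P" for p
      unfolding Y_def using that by simp
    moreover have "Y (i, j) = Y (j, i)" for i j
      by (auto simp: Y_def sym)
    ultimately show "Y \<in> K"
      by (auto simp: K_def)
    have "frob n X * ?f Y = frob n (\<lambda>p. frob n X * masked_mult n M Y A p)"
      by (simp add: L2_set_cmult)
    also have "\<dots> = ?f X"
      using pos by (intro L2_set_cong)
        (auto simp: masked_mult_def Y_def sum_distrib_left intro!: sum.cong)
    finally show "?f X = frob n X * ?f Y" ..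
  qed
  show ?thesis
  proof (cases "K = {}")
    \<comment> \<open>Without unit vectors, as for \<open>n = 0\<close>, every symmetric
      \<open>X\<close> has norm 0, and 1 is an arbitrary choice of constant.\<close>
    case True
    have "1 * frob n X \<le> ?f X" if "\<And>i j. i < n \<Longrightarrow> j < n \<Longrightarrow> X (i, j) = X (j, i)" for X
    proof (cases "frob n X = 0")
      case False
      then have "frob n X > 0" by (simp add: order_less_le)
      then show ?thesis using normalise[of X] that True by blast
    qed simp
    then show ?thesis by (intro that[of 1]) auto
  next
    case False
    from continuous_attains_inf[OF \<open>compact K\<close> this continuous_on_subset[OF cont]]
    obtain Y where Y: "Y \<in> K" and min: "\<And>Z. Z \<in> K \<Longrightarrow> ?f Y \<le> ?f Z" by auto
    have "?f Y > 0"
    proof (rule ccontr)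
      assume "\<not> ?f Y > 0"
      then have "?f Y = 0" by (simp add: order_less_le)
      then have "masked_mult n M Y A p = 0" if "p \<in> ?P" for p
        using that by (subst (asm) L2_set_eq_0_iff) auto
      moreover have "Y p = 0" if "p \<notin> ?P" for p
      proof -
        have "\<bar>Y p\<bar> \<le> (if p \<in> ?P then 1 else 0)"
          using Y unfolding K_def by blast
        then show ?thesis using that by simp
      qed
      moreover have "Y (i, j) = Y (j, i)" for i j
        using Y unfolding K_def by blast
      ultimately have "\<forall>p. Y p = 0"
        by (intro inj)
      then have "frob n Y = 0" by (intro L2_set_0') auto
      then show False using Y unfolding K_def by simp
    qed
    moreover have "?f Y * frob n X \<le> ?f X"
      if "\<And>i j. i < n \<Longrightarrow> j < n \<Longrightarrow> X (i, j) = X (j, i)" for X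
    proof (cases "frob n X = 0")
      case False
      then have "frob n X > 0" by (simp add: order_less_le)
      from normalise[of X] that this obtain Z where "Z \<in> K" "?f X = frob n X * ?f Z" by blast
      then show ?thesis using min[of Z] by (simp add: mult.commute mult_left_mono)
    qed simp
    ultimately show ?thesis by (intro that[of "?f Y"]) auto
  qed
qed

section \<open>The exact penalty function: existence and stationarity of minimisers\<close>

text \<open>The penalty term is coercive: a competitor with an entry too far from \<open>C\<close>
  costs at least as much as \<open>C\<close> itself, so minimising over a compact box around
  \<open>C\<close> suffices.\<close>

lemma exact_penalty_minimiser:
  assumes "c > 0" and C: "\<And>p. p \<notin> M \<Longrightarrow> C p = 0" and M: "M \<subseteq> {..<n} \<times> {..<n}"
  obtains A where "\<And>p. p \<notin> M \<Longrightarrow> A p = 0"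
    and "\<And>A'. (\<And>p. p \<notin> M \<Longrightarrow> A' p = 0) \<Longrightarrow>
      frob n (gram_defect n A) + c * frob n (\<lambda>p. A p - C p)
      \<le> frob n (gram_defect n A') + c * frob n (\<lambda>p. A' p - C p)"
proof -
  let ?P = "{..<n} \<times> {..<n}"
  let ?f = "\<lambda>A. frob n (gram_defect n A) + c * frob n (\<lambda>p. A p - C p)"
  \<comment> \<open>The radius is chosen so that an entry deviating from \<open>C\<close> by more
    than \<open>?f C / c\<close> has a penalty above \<open>?f C\<close>.\<close>
  define K where "K = {A. \<forall>p. \<bar>A p\<bar> \<le> (if p \<in> M then \<bar>C p\<bar> + ?f C / c else 0)}"
  have nonneg: "?f C / c \<ge> 0"
    using \<open>c > 0\<close> by simp
  have "compact K"
    unfolding K_def by (rule compact_abs_le_box)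
  moreover have "C \<in> K"
    using nonneg C by (auto simp: K_def)
  moreover have "continuous_on K ?f"
    unfolding gram_defect_def
    by (intro continuous_intros, simp add: split_def) (auto intro!: continuous_intros)
  ultimately obtain A where A: "A \<in> K" and min: "\<And>A'. A' \<in> K \<Longrightarrow> ?f A \<le> ?f A'"
    using continuous_attains_inf[of K ?f] by blast
  show ?thesis
  proof
    show "A p = 0" if "p \<notin> M" for p
    proof -
      have "\<bar>A p\<bar> \<le> (if p \<in> M then \<bar>C p\<bar> + ?f C / c else 0)"
        using A unfolding K_def by blast
      then show ?thesis using that by simp
    qed
    show "?f A \<le> ?f A'" if A': "\<And>p. p \<notin> M \<Longrightarrow> A' p = 0" for A'
    proof (cases "A' \<in> K")
      case False
      then obtain p where p: "\<bar>A' p\<bar> > (if p \<in> M then \<bar>C p\<bar> + ?f C / c else 0)"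
        unfolding K_def by (auto simp: not_le)
      then have "p \<in> M" using A'[of p] by (auto split: if_splits)
      then have "?f C / c < \<bar>A' p - C p\<bar>" using p by simp
      also have "\<dots> \<le> frob n (\<lambda>p. A' p - C p)"
        using \<open>p \<in> M\<close> M by (intro abs_le_L2_set) auto
      finally have "?f C \<le> c * frob n (\<lambda>p. A' p - C p)"
        using \<open>c > 0\<close> by (simp add: field_simps)
      also have "\<dots> \<le> ?f A'" by simp
      finally show ?thesis using min[OF \<open>C \<in> K\<close>] by linarith
    qed (rule min)
  qed
qed

text \<open>First-order condition at a minimiser, obtained by moving along the negative masked
  gradient of the squared norm of the Gram defect.\<close>

lemma exact_penalty_stationary:
  fixes n :: nat and M :: "(nat \<times> nat) set" and A :: "nat \<times> nat \<Rightarrow> real"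
  defines "X \<equiv> gram_defect n A"
  defines "V \<equiv> masked_mult n M X A"
  assumes "c \<ge> 0"
    and min: "\<And>s. s > 0 \<Longrightarrow>
      frob n X \<le> frob n (gram_defect n (\<lambda>p. A p - s * V p)) + c * s * frob n V"
  shows "2 * frob n V \<le> c * frob n X"
proof (cases "frob n X = 0 \<or> frob n V = 0")
  case True
  have "frob n V = 0" if "frob n X = 0"
    using frob_masked_mult_le[of n M X A] that unfolding V_def
    by (metis L2_set_nonneg mult_zero_left order_antisym)
  with True \<open>c \<ge> 0\<close> show ?thesis by auto
next
  case False
  let ?P = "{..<n} \<times> {..<n}"
  \<comment> \<open>\<open>K\<close> is the derivative of \<open>A A^T\<close> in direction
    \<open>V\<close>, and \<open>W\<close> is \<open>V V^T\<close>; hence the Gram defect of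
    \<open>A - s V\<close> is \<open>X - s K + s^2 W\<close>.\<close>
  define K where "K = (\<lambda>(i, j). \<Sum>l<n. V (i, l) * A (j, l) + A (i, l) * V (j, l))"
  define W where "W = (\<lambda>(i, j). \<Sum>l<n. V (i, l) * V (j, l))"
  define x v k w where "x = frob n X" and "v = frob n V" and "k = frob n K" and "w = frob n W"
  have "x > 0" "v > 0" using False by (auto simp: x_def v_def order_less_le)
  have sym: "X (i, j) = X (j, i)" for i j
    by (auto simp: X_def gram_defect_def mult.commute)
  \<comment> \<open>Moving \<open>A\<close> to the other side of the inner product turns this into
    that of \<open>X A\<close> with \<open>V\<close>; as \<open>V\<close> is \<open>X A\<close>
    restricted to \<open>M\<close>, only the squares of \<open>V\<close> remain.\<close>
  have half: "(\<Sum>i<n. \<Sum>j<n. X (i, j) * (\<Sum>l<n. V (i, l) * A (j, l))) = v\<^sup>2"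
  proof -
    have "(\<Sum>i<n. \<Sum>j<n. X (i, j) * (\<Sum>l<n. V (i, l) * A (j, l)))
        = (\<Sum>i<n. \<Sum>j<n. \<Sum>l<n. V (i, l) * (X (i, j) * A (j, l)))"
      by (simp add: sum_distrib_left mult_ac)
    also have "\<dots> = (\<Sum>i<n. \<Sum>l<n. \<Sum>j<n. V (i, l) * (X (i, j) * A (j, l)))"
      by (intro sum.cong refl sum.swap)
    also have "\<dots> = (\<Sum>i<n. \<Sum>l<n. (V (i, l))\<^sup>2)"
      by (intro sum.cong refl)
        (auto simp: V_def masked_mult_def power2_eq_square sum_distrib_left)
    finally show ?thesis
      by (simp add: v_def L2_set_power2 sum.cartesian_product)
  qed
  have "(\<Sum>i<n. \<Sum>j<n. X (i, j) * K (i, j))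
      = (\<Sum>i<n. \<Sum>j<n. X (i, j) * (\<Sum>l<n. V (i, l) * A (j, l)))
      + (\<Sum>i<n. \<Sum>j<n. X (i, j) * (\<Sum>l<n. V (j, l) * A (i, l)))"
    by (simp add: K_def sum.distrib algebra_simps)
  \<comment> \<open>Exchanging \<open>i\<close> and \<open>j\<close> identifies the two halves,
    since \<open>X\<close> is symmetric.\<close>
  also have "(\<Sum>i<n. \<Sum>j<n. X (i, j) * (\<Sum>l<n. V (j, l) * A (i, l)))
      = (\<Sum>i<n. \<Sum>j<n. X (i, j) * (\<Sum>l<n. V (i, l) * A (j, l)))"
    by (subst sum.swap) (simp add: sym)
  finally have inner: "(\<Sum>p\<in>?P. X p * K p) = 2 * v\<^sup>2"
    using half by (simp add: sum.cartesian_product)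
  have step: "2 * v\<^sup>2 / x - c * v \<le> s * (k\<^sup>2 / (2 * x) + w)" if "s > 0" for s
  proof -
    define h where "h = s\<^sup>2 * k\<^sup>2 - 4 * s * v\<^sup>2"
    have sq: "(frob n (\<lambda>p. X p - s * K p))\<^sup>2 = x\<^sup>2 + h"
    proof -
      have "(frob n (\<lambda>p. X p - s * K p))\<^sup>2
          = (\<Sum>p\<in>?P. (X p)\<^sup>2 + s\<^sup>2 * (K p)\<^sup>2 - 2 * s * (X p * K p))"
        unfolding L2_set_power2 by (intro sum.cong) (auto simp: power2_eq_square algebra_simps)
      also have "\<dots> = x\<^sup>2 + s\<^sup>2 * k\<^sup>2 - 2 * s * (2 * v\<^sup>2)"
        unfolding inner[symmetric]
        by (simp add: sum.distrib sum_subtractf sum_distrib_left x_def k_def L2_set_power2)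
      finally show ?thesis by (simp add: h_def)
    qed
    \<comment> \<open>The square root lies below its tangent at \<open>x^2\<close>. This
      linearisation requires \<open>x > 0\<close>, the reason for the case split above.\<close>
    have "frob n (\<lambda>p. X p - s * K p) \<le> x + h / (2 * x)"
    proof (rule power2_le_imp_le)
      show "(frob n (\<lambda>p. X p - s * K p))\<^sup>2 \<le> (x + h / (2 * x))\<^sup>2"
        using \<open>x > 0\<close> unfolding sq by (simp add: power2_sum)
      have "x\<^sup>2 + h \<ge> 0" using sq by (metis zero_le_power2)
      then have "2 * x\<^sup>2 + h \<ge> 0" using zero_le_power2[of x] by linarith
      then have "(2 * x\<^sup>2 + h) / (2 * x) \<ge> 0" using \<open>x > 0\<close> by simp
      then show "0 \<le> x + h / (2 * x)"
        using \<open>x > 0\<close> by (simp add: field_simps power2_eq_square)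
    qed
    moreover have "frob n (gram_defect n (\<lambda>p. A p - s * V p))
        = frob n (\<lambda>p. (X p - s * K p) + s\<^sup>2 * W p)"
      by (intro L2_set_cong)
        (auto simp: gram_defect_def X_def K_def W_def sum_distrib_left sum.distrib sum_subtractf
           algebra_simps power2_eq_square)
    moreover have "\<dots> \<le> frob n (\<lambda>p. X p - s * K p) + frob n (\<lambda>p. s\<^sup>2 * W p)"
      by (rule L2_set_triangle_ineq)
    moreover have "frob n (\<lambda>p. s\<^sup>2 * W p) = s\<^sup>2 * w"
      by (simp add: L2_set_cmult w_def)
    ultimately have "0 \<le> h / (2 * x) + s\<^sup>2 * w + c * s * v"
      using min[OF that] unfolding x_def[symmetric] v_def[symmetric] by linarith
    also have "\<dots> = s * (s * (k\<^sup>2 / (2 * x) + w) - (2 * v\<^sup>2 / x - c * v))"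
      using \<open>x > 0\<close> by (simp add: h_def field_simps power2_eq_square)
    finally show ?thesis
      using that by (simp add: zero_le_mult_iff)
  qed
  \<comment> \<open>The left side of \<open>step\<close> is free of \<open>s\<close>, so letting
    \<open>s\<close> tend to 0 from the right leaves the first-order condition.\<close>
  have "2 * v\<^sup>2 / x - c * v \<le> 0"
  proof (rule tendsto_lowerbound)
    show "((\<lambda>s. s * (k\<^sup>2 / (2 * x) + w)) \<longlongrightarrow> 0) (at_right 0)"
      by (auto intro!: tendsto_eq_intros)
    show "\<forall>\<^sub>F s in at_right 0. 2 * v\<^sup>2 / x - c * v \<le> s * (k\<^sup>2 / (2 * x) + w)"
      using eventually_at_right_less by (rule eventually_mono) (rule step)
  qed simp
  then have "v * (2 * v) \<le> v * (c * x)"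
    using \<open>x > 0\<close> by (simp add: field_simps power2_eq_square)
  then show ?thesis
    using \<open>v > 0\<close> by (simp add: x_def v_def)
qed

section \<open>Perturbing along a tangent direction\<close>

text \<open>The penalty weight is the constant \<open>\<delta>\<close> of the lower bound.
  Stationarity then yields \<open>\<delta> / 2\<close> where the lower bound yields
  \<open>\<delta>\<close>, and the gap absorbs the distance from \<open>A\<close> to
  \<open>Q\<close>.\<close>

lemma orthogonal_perturbation:
  fixes Q B :: "nat \<times> nat \<Rightarrow> real"
  assumes M: "M \<subseteq> {..<n} \<times> {..<n}"
    and supp: "M = {p. Q p \<noteq> 0 \<or> B p \<noteq> 0}"
    and orth: "\<And>p. p \<in> {..<n} \<times> {..<n} \<Longrightarrow> gram_defect n Q p = 0"
    and tangent: "\<And>i j. i < n \<Longrightarrow> j < n \<Longrightarrow>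
      (\<Sum>l<n. Q (i, l) * B (j, l)) + (\<Sum>l<n. B (i, l) * Q (j, l)) = 0"
    and inj: "\<And>X. \<lbrakk>\<And>p. p \<notin> {..<n} \<times> {..<n} \<Longrightarrow> X p = 0; \<And>i j. X (i, j) = X (j, i);
                  \<And>p. p \<in> {..<n} \<times> {..<n} \<Longrightarrow> masked_mult n M X Q p = 0\<rbrakk> \<Longrightarrow> \<forall>p. X p = 0"
  obtains A where "\<And>p. p \<in> {..<n} \<times> {..<n} \<Longrightarrow> gram_defect n A p = 0"
    and "\<And>p. sgn (A p) = (if Q p \<noteq> 0 then sgn (Q p) else sgn (B p))"
proof -
  let ?P = "{..<n} \<times> {..<n}"
  have Q: "Q p = 0" and B: "B p = 0" if "p \<notin> M" for p
    using that supp by auto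
  from masked_mult_lower_bound[OF inj] obtain \<delta> where "\<delta> > 0"
    and lower: "\<And>X. (\<And>i j. i < n \<Longrightarrow> j < n \<Longrightarrow> X (i, j) = X (j, i)) \<Longrightarrow>
      \<delta> * frob n X \<le> frob n (masked_mult n M X Q)" by blast
  define b where "b = frob n B"
  define w where "w = frob n (\<lambda>(i, j). \<Sum>l<n. B (i, l) * B (j, l))"
  \<comment> \<open>Bound for the distance from \<open>A\<close> to \<open>Q\<close>:
    \<open>t * b\<close> covers the move from \<open>Q\<close> to \<open>C\<close>, and
    \<open>t^2 * w / \<delta>\<close> the one from \<open>C\<close> to \<open>A\<close>.\<close>
  define r where "r = (\<lambda>t. t * b + t\<^sup>2 * w / \<delta>)"
  have fin: "finite M" using M finite_subset by blast
  have r: "(r \<longlongrightarrow> 0) (at_right 0)"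
    unfolding r_def using \<open>\<delta> > 0\<close> by (auto intro!: tendsto_eq_intros)
  have tw: "((\<lambda>t. t * w / \<delta>) \<longlongrightarrow> 0) (at_right 0)"
    using \<open>\<delta> > 0\<close> by (auto intro!: tendsto_eq_intros)
  \<comment> \<open>The conditions on \<open>t\<close> serve, in order, to force a zero Gram defect,
    to keep the signs of the nonzero entries of \<open>Q\<close>, and to keep those of
    \<open>B\<close> where \<open>Q\<close> vanishes (the error bound divided by
    \<open>t\<close>).\<close>
  have "\<forall>\<^sub>F t in at_right 0. t > 0 \<and> r t < \<delta> / 2
      \<and> (\<forall>p\<in>M. Q p \<noteq> 0 \<longrightarrow> r t < \<bar>Q p\<bar>) \<and> (\<forall>p\<in>M. B p \<noteq> 0 \<longrightarrow> t * w / \<delta> < \<bar>B p\<bar>)"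
  proof (intro eventually_conj eventually_ball_finite fin ballI)
    show "\<forall>\<^sub>F t in at_right 0. r t < \<delta> / 2"
      using \<open>\<delta> > 0\<close> by (intro order_tendstoD(2)[OF r]) simp
    show "\<forall>\<^sub>F t in at_right 0. Q p \<noteq> 0 \<longrightarrow> r t < \<bar>Q p\<bar>" for p
      using order_tendstoD(2)[OF r, of "\<bar>Q p\<bar>"] by (cases "Q p = 0") auto
    show "\<forall>\<^sub>F t in at_right 0. B p \<noteq> 0 \<longrightarrow> t * w / \<delta> < \<bar>B p\<bar>" for p
      using order_tendstoD(2)[OF tw, of "\<bar>B p\<bar>"] by (cases "B p = 0") auto
  qed (rule eventually_at_right_less)
  from eventually_happens[OF this] obtain t where "t > 0" and rd: "r t < \<delta> / 2"
    and rQ: "\<And>p. p \<in> M \<Longrightarrow> Q p \<noteq> 0 \<Longrightarrow> r t < \<bar>Q p\<bar>"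
    and rB: "\<And>p. p \<in> M \<Longrightarrow> B p \<noteq> 0 \<Longrightarrow> t * w / \<delta> < \<bar>B p\<bar>" by auto
  define C where "C = (\<lambda>p. Q p + t * B p)"
  obtain A where A: "\<And>p. p \<notin> M \<Longrightarrow> A p = 0"
    and min: "\<And>A'. (\<And>p. p \<notin> M \<Longrightarrow> A' p = 0) \<Longrightarrow>
      frob n (gram_defect n A) + \<delta> * frob n (\<lambda>p. A p - C p)
      \<le> frob n (gram_defect n A') + \<delta> * frob n (\<lambda>p. A' p - C p)"
    using exact_penalty_minimiser[OF \<open>\<delta> > 0\<close> _ M, of C] Q B by (auto simp: C_def)
  \<comment> \<open>Of the expansion in \<open>t\<close>, the constant term vanishes by
    \<open>orth\<close> and the linear term by \<open>tangent\<close>.\<close>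
  have "frob n (gram_defect n C) = frob n (\<lambda>p. t\<^sup>2 * (\<lambda>(i, j). \<Sum>l<n. B (i, l) * B (j, l)) p)"
  proof (intro L2_set_cong refl)
    fix p assume "p \<in> ?P"
    then obtain i j where p: "p = (i, j)" "i < n" "j < n" by auto
    have "gram_defect n C p = gram_defect n Q p
        + t * ((\<Sum>l<n. Q (i, l) * B (j, l)) + (\<Sum>l<n. B (i, l) * Q (j, l)))
        + t\<^sup>2 * (\<Sum>l<n. B (i, l) * B (j, l))"
      by (simp add: p C_def gram_defect_def algebra_simps sum.distrib sum_distrib_left power2_eq_square)
    then show "gram_defect n C p = t\<^sup>2 * (\<lambda>(i, j). \<Sum>l<n. B (i, l) * B (j, l)) p"
      using orth[OF \<open>p \<in> ?P\<close>] tangent p by simp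
  qed
  then have "frob n (gram_defect n C) = t\<^sup>2 * w"
    by (simp add: L2_set_cmult w_def)
  moreover have "frob n (\<lambda>p. C p - C p) = 0"
    by (intro L2_set_0') auto
  moreover have "C p = 0" if "p \<notin> M" for p
    using Q B that by (simp add: C_def)
  ultimately have "frob n (gram_defect n A) + \<delta> * frob n (\<lambda>p. A p - C p) \<le> t\<^sup>2 * w"
    using min[of C] by simp
  then have "\<delta> * frob n (\<lambda>p. A p - C p) \<le> t\<^sup>2 * w"
    by (rule order_trans[rotated]) simp
  then have AC: "frob n (\<lambda>p. A p - C p) \<le> t\<^sup>2 * w / \<delta>"
    using \<open>\<delta> > 0\<close> by (simp add: field_simps)
  have "frob n (\<lambda>p. A p - Q p) = frob n (\<lambda>p. (A p - C p) + t * B p)"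
    by (simp add: C_def)
  also have "\<dots> \<le> frob n (\<lambda>p. A p - C p) + frob n (\<lambda>p. t * B p)"
    by (rule L2_set_triangle_ineq)
  also have "\<dots> \<le> r t"
    using AC \<open>t > 0\<close> by (simp add: L2_set_cmult r_def b_def)
  finally have AQ: "frob n (\<lambda>p. A p - Q p) \<le> r t" .

  define X where "X = gram_defect n A"
  define V where "V = masked_mult n M X A"
  have "2 * frob n V \<le> \<delta> * frob n X"
    unfolding V_def X_def
  proof (rule exact_penalty_stationary)
    fix s :: real assume "s > 0"
    let ?V = "masked_mult n M (gram_defect n A) A"
    let ?A' = "\<lambda>p. A p - s * ?V p"
    have "frob n (gram_defect n A) + \<delta> * frob n (\<lambda>p. A p - C p)
        \<le> frob n (gram_defect n ?A') + \<delta> * frob n (\<lambda>p. ?A' p - C p)"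
      \<comment> \<open>The competitor is admissible because the masked gradient is supported on
        \<open>M\<close>.\<close>
      using A by (intro min) (auto simp: masked_mult_def split: prod.splits)
    moreover have "frob n (\<lambda>p. ?A' p - C p) \<le> frob n (\<lambda>p. A p - C p) + s * frob n ?V"
      using L2_set_triangle_ineq[of "\<lambda>p. A p - C p" "\<lambda>p. - s * ?V p" ?P] \<open>s > 0\<close>
      unfolding L2_set_cmult by (simp add: algebra_simps)
    then have "\<delta> * frob n (\<lambda>p. ?A' p - C p) \<le> \<delta> * (frob n (\<lambda>p. A p - C p) + s * frob n ?V)"
      using \<open>\<delta> > 0\<close> by simp
    ultimately show "frob n (gram_defect n A)
        \<le> frob n (gram_defect n ?A') + \<delta> * s * frob n ?V"
      by (simp add: algebra_simps)
  qed (use \<open>\<delta> > 0\<close> in simp)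
  \<comment> \<open>The lower bound holds at \<open>Q\<close>; passing to \<open>A\<close> costs at
    most \<open>frob n X * r t\<close>.\<close>
  moreover have "\<delta> * frob n X \<le> frob n V + frob n X * r t"
  proof -
    have "\<delta> * frob n X \<le> frob n (masked_mult n M X Q)"
      by (intro lower) (auto simp: X_def gram_defect_def mult.commute)
    also have "\<dots> = frob n (\<lambda>p. V p + - 1 * masked_mult n M X (\<lambda>p. A p - Q p) p)"
      by (intro L2_set_cong)
        (auto simp: V_def masked_mult_def algebra_simps sum_subtractf)
    also have "\<dots> \<le> frob n V + frob n (masked_mult n M X (\<lambda>p. A p - Q p))"
      by (rule order_trans[OF L2_set_triangle_ineq]) (subst L2_set_cmult, simp)
    also have "\<dots> \<le> frob n V + frob n X * frob n (\<lambda>p. A p - Q p)"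
      by (simp add: frob_masked_mult_le)
    also have "\<dots> \<le> frob n V + frob n X * r t"
      using AQ by (simp add: mult_left_mono)
    finally show ?thesis .
  qed
  ultimately have "frob n X * (\<delta> / 2 - r t) \<le> 0"
    by (simp add: algebra_simps)
  then have "frob n X = 0"
    using rd L2_set_nonneg[of X ?P] by (simp add: mult_le_0_iff)
  show ?thesis
  proof
    show "gram_defect n A p = 0" if "p \<in> ?P" for p
      using \<open>frob n X = 0\<close> that unfolding X_def by (subst (asm) L2_set_eq_0_iff) auto
    show "sgn (A p) = (if Q p \<noteq> 0 then sgn (Q p) else sgn (B p))" for p
    proof (cases "p \<in> M")
      case False
      then show ?thesis using A Q B by simp
    next
      case True
      then have "p \<in> ?P" using M by blast
      show ?thesis
      proof (cases "Q p = 0")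
        case False
        have "\<bar>A p - Q p\<bar> \<le> r t"
          using abs_le_L2_set[OF _ \<open>p \<in> ?P\<close>, of "\<lambda>p. A p - Q p"] AQ by simp
        with rQ[OF True False] have "\<bar>A p - Q p\<bar> < \<bar>Q p\<bar>" by linarith
        with False show ?thesis by (auto simp: sgn_if abs_if split: if_splits)
      next
        case Q0: True
        \<comment> \<open>Here \<open>C p\<close> is \<open>t * B p\<close>, linear in
          \<open>t\<close>, whereas the error is quadratic; for this \<open>t\<close> the linear
          term decides the sign.\<close>
        have "\<bar>A p - t * B p\<bar> \<le> t\<^sup>2 * w / \<delta>"
          using abs_le_L2_set[OF _ \<open>p \<in> ?P\<close>, of "\<lambda>p. A p - C p"] AC Q0 by (simp add: C_def)
        also have "\<dots> = t * (t * w / \<delta>)"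
          by (simp add: power2_eq_square)
        finally have le: "\<bar>A p - t * B p\<bar> \<le> t * (t * w / \<delta>)" .
        have "B p \<noteq> 0" using Q0 True supp by simp
        have "t * (t * w / \<delta>) < t * \<bar>B p\<bar>"
          using rB[OF True \<open>B p \<noteq> 0\<close>] \<open>t > 0\<close> by (rule mult_strict_left_mono)
        also have "\<dots> = \<bar>t * B p\<bar>"
          using \<open>t > 0\<close> by (simp add: abs_mult)
        finally have "\<bar>A p - t * B p\<bar> < \<bar>t * B p\<bar>" using le by linarith
        then have "sgn (A p) = sgn (t * B p)"
          by (auto simp: sgn_if abs_if split: if_splits)
        then show ?thesis using Q0 \<open>t > 0\<close> by (simp add: sgn_mult)
      qed
    qed
  qed
qed

section \<open>Block offsets and entries of block diagonal matrices\<close>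

lemma less_sum_blocks:
  fixes ns :: "nat \<Rightarrow> nat"
  assumes "i < k" "a < ns i"
  shows "(\<Sum>l<i. ns l) + a < (\<Sum>l<k. ns l)"
proof -
  have "(\<Sum>l<i. ns l) + a < (\<Sum>l<Suc i. ns l)" using assms by simp
  also have "\<dots> \<le> (\<Sum>l<k. ns l)" using assms by (intro sum_mono2) auto
  finally show ?thesis .
qed

lemma block_index_cases:
  fixes ns :: "nat \<Rightarrow> nat"
  assumes "p < (\<Sum>l<k. ns l)"
  obtains i a where "i < k" "a < ns i" "p = (\<Sum>l<i. ns l) + a"
  using assms
proof (induction k arbitrary: thesis)
  case (Suc k)
  show ?case
  proof (cases "p < (\<Sum>l<k. ns l)")
    case True
    then show ?thesis using Suc.IH Suc.prems(1) less_Suc_eq by metis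
  next
    case False
    then show ?thesis using Suc.prems(2) by (intro Suc.prems(1)[of k "p - (\<Sum>l<k. ns l)"]) auto
  qed
qed simp

lemma sum_blocks:
  fixes ns :: "nat \<Rightarrow> nat"
  shows "(\<Sum>p<(\<Sum>l<k. ns l). f p) = (\<Sum>i<k. \<Sum>a<ns i. f ((\<Sum>l<i. ns l) + a))"
proof (induction k)
  case (Suc k)
  have "sum f {..<m + c} = sum f {..<m} + (\<Sum>a<c. f (m + a))" for m c :: nat
    by (induction c) (auto simp: add.assoc)
  with Suc show ?case by simp
qed simp

lemma diag_block_mat_carrier:
  fixes Qs :: "nat \<Rightarrow> 'a :: zero mat"
  assumes Qs: "\<And>i. i < k \<Longrightarrow> Qs i \<in> carrier_mat (ns i) (ns i)"
  shows "diag_block_mat (map Qs [0..<k]) \<in> carrier_mat (\<Sum>i<k. ns i) (\<Sum>i<k. ns i)"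
proof -
  have "map (dim_row \<circ> Qs) [0..<k] = map ns [0..<k]" "map (dim_col \<circ> Qs) [0..<k] = map ns [0..<k]"
    by (simp_all add: Qs[THEN carrier_matD(1)] Qs[THEN carrier_matD(2)])
  then show ?thesis
    by (intro carrier_matI)
      (simp_all add: dim_diag_block_mat sum_list_distinct_conv_sum_set lessThan_atLeast0)
qed

text \<open>Induction splits off the last block; comparing \<open>i\<close> and \<open>j\<close>
  with \<open>k\<close> decides which of the four resulting blocks contains the entry.\<close>

lemma diag_block_mat_index:
  fixes Qs :: "nat \<Rightarrow> 'a :: zero mat"
  assumes "\<And>i. i < k \<Longrightarrow> Qs i \<in> carrier_mat (ns i) (ns i)"
    and "i < k" "j < k" "a < ns i" "b < ns j"
  shows "diag_block_mat (map Qs [0..<k]) $$ ((\<Sum>l<i. ns l) + a, (\<Sum>l<j. ns l) + b)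
    = (if i = j then Qs i $$ (a, b) else 0)"
  using assms
proof (induction k)
  case (Suc k)
  let ?D = "diag_block_mat (map Qs [0..<k])"
  have D: "dim_row ?D = (\<Sum>i<k. ns i)" "dim_col ?D = (\<Sum>i<k. ns i)"
    using diag_block_mat_carrier[of k Qs ns] Suc.prems(1) by auto
  have Qk: "dim_row (Qs k) = ns k" "dim_col (Qs k) = ns k"
    using Suc.prems(1)[of k] by auto
  have less: "(\<Sum>l<m. ns l) + c < (\<Sum>l<k. ns l)" if "m < k" "c < ns m" for m c
    using that by (rule less_sum_blocks)
  have nless: "\<not> (\<Sum>l<m. ns l) + c < (\<Sum>l<k. ns l)" if "\<not> m < k" "m < Suc k" for m c
    using that by (simp add: less_Suc_eq)
  have trans: "m < k + c" if "m < k" for m k c :: nat using that by simp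
  show ?case
    using Suc.prems Suc.IH
    by (cases "i < k"; cases "j < k")
      (simp_all add: diag_block_mat_last Let_def D Qk less nless trans less_Suc_eq
         del: diag_block_mat.simps)
qed simp

section \<open>Products with a block diagonal matrix\<close>

context
  fixes k n :: nat and ns :: "nat \<Rightarrow> nat" and Qs :: "nat \<Rightarrow> real mat" and Q :: "real mat"
  assumes Qs: "\<And>i. i < k \<Longrightarrow> Qs i \<in> carrier_mat (ns i) (ns i)"
    and Q: "Q = diag_block_mat (map Qs [0..<k])"
    and n: "(\<Sum>i<k. ns i) = n"
begin

text \<open>Only the diagonal block meets this row. Together with the column version, this reduces
  products with \<open>Q\<close> to products of blocks.\<close>

lemma diag_block_mat_row_sum:
  assumes "i < k" "a < ns i"
  shows "(\<Sum>u<n. Q $$ ((\<Sum>l<i. ns l) + a, u) * f u)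
    = (\<Sum>b<ns i. Qs i $$ (a, b) * f ((\<Sum>l<i. ns l) + b))"
proof -
  have "(\<Sum>u<n. Q $$ ((\<Sum>l<i. ns l) + a, u) * f u)
      = (\<Sum>j<k. \<Sum>b<ns j. (if i = j then Qs i $$ (a, b) else 0) * f ((\<Sum>l<j. ns l) + b))"
    unfolding n[symmetric] sum_blocks using assms
    by (intro sum.cong refl) (simp add: Q diag_block_mat_index[OF Qs])
  also have "\<dots> = (\<Sum>j<k. if i = j then \<Sum>b<ns j. Qs i $$ (a, b) * f ((\<Sum>l<j. ns l) + b) else 0)"
    by (intro sum.cong) auto
  finally show ?thesis using assms by simp
qed

lemma diag_block_mat_col_sum:
  assumes "j < k" "b < ns j"
  shows "(\<Sum>v<n. f v * Q $$ (v, (\<Sum>l<j. ns l) + b))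
    = (\<Sum>a<ns j. f ((\<Sum>l<j. ns l) + a) * Qs j $$ (a, b))"
proof -
  have "(\<Sum>v<n. f v * Q $$ (v, (\<Sum>l<j. ns l) + b))
      = (\<Sum>i<k. \<Sum>a<ns i. f ((\<Sum>l<i. ns l) + a) * (if i = j then Qs i $$ (a, b) else 0))"
    unfolding n[symmetric] sum_blocks using assms
    by (intro sum.cong refl) (simp add: Q diag_block_mat_index[OF Qs])
  also have "\<dots> = (\<Sum>i<k. if i = j then \<Sum>a<ns i. f ((\<Sum>l<i. ns l) + a) * Qs i $$ (a, b) else 0)"
    by (intro sum.cong) auto
  finally show ?thesis using assms by simp
qed

lemma diag_block_mat_orthogonal:
  assumes "\<And>i. i < k \<Longrightarrow> real_orthogonal_mat (Qs i)"
  shows "Q * transpose_mat Q = 1\<^sub>m n"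
proof (rule eq_matI)
  have carrier: "Q \<in> carrier_mat n n"
    using diag_block_mat_carrier[of k Qs ns] Qs Q n by auto
  fix p q assume pq: "p < dim_row (1\<^sub>m n)" "q < dim_col (1\<^sub>m n)"
  obtain i a where i: "i < k" "a < ns i" "p = (\<Sum>l<i. ns l) + a"
    using block_index_cases[of p ns k] pq n by auto
  obtain j b where j: "j < k" "b < ns j" "q = (\<Sum>l<j. ns l) + b"
    using block_index_cases[of q ns k] pq n by auto
  have "(Q * transpose_mat Q) $$ (p, q) = (\<Sum>u<n. Q $$ (p, u) * Q $$ (q, u))"
    using carrier pq by (simp add: scalar_prod_def lessThan_atLeast0)
  also have "\<dots> = (\<Sum>c<ns i. Qs i $$ (a, c) * (if j = i then Qs j $$ (b, c) else 0))"
    using i j by (simp add: diag_block_mat_row_sum) (simp add: Q diag_block_mat_index[OF Qs])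
  also have "\<dots> = of_bool (p = q)"
  proof (cases "i = j")
    case True
    \<comment> \<open>Orthogonality is defined through columns, while the Gram defect compares rows;
      for square matrices a left inverse is also a right inverse.\<close>
    have "Qs i * transpose_mat (Qs i) = 1\<^sub>m (ns i)"
      by (rule mat_mult_left_right_inverse[rotated 2])
        (use assms[OF i(1)] Qs[OF i(1)] in \<open>auto simp: real_orthogonal_mat_def\<close>)
    then have "(Qs i * transpose_mat (Qs i)) $$ (a, b) = of_bool (a = b)"
      using i j True by simp
    moreover have "(Qs i * transpose_mat (Qs i)) $$ (a, b) = (\<Sum>c<ns i. Qs i $$ (a, c) * Qs i $$ (b, c))"
      using Qs[OF i(1)] i j True by (simp add: scalar_prod_def lessThan_atLeast0)
    ultimately show ?thesis using True i j by simp
  next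
    case False
    then have "p \<noteq> q"
      using less_sum_blocks[of i j a ns] less_sum_blocks[of j i b ns] i j by (cases "i < j") auto
    with False show ?thesis by simp
  qed
  finally show "(Q * transpose_mat Q) $$ (p, q) = 1\<^sub>m n $$ (p, q)"
    using pq by simp
qed (use diag_block_mat_carrier[of k Qs ns] Qs Q n in auto)

text \<open>As \<open>Q\<close> is block diagonal, the \<open>(i, j)\<close> block of
  \<open>Q B^T Q\<close> involves only \<open>Qs i\<close>, the transposed \<open>(j, i)\<close>
  block of \<open>B\<close>, and \<open>Qs j\<close>.\<close>

lemma block_skew_imp_skew:
  assumes B: "B \<in> carrier_mat n n"
    and blocks: "\<And>i j. i < k \<Longrightarrow> j < k \<Longrightarrow>
      mat_block ns B i j = - (Qs i * transpose_mat (mat_block ns B j i) * Qs j)"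
  shows "B = - (Q * transpose_mat B * Q)"
proof (rule eq_matI)
  have carrier: "Q \<in> carrier_mat n n"
    using diag_block_mat_carrier[of k Qs ns] Qs Q n by auto
  show "dim_row B = dim_row (- (Q * transpose_mat B * Q))"
    "dim_col B = dim_col (- (Q * transpose_mat B * Q))"
    using B carrier by auto
  fix p q assume "p < dim_row (- (Q * transpose_mat B * Q))" "q < dim_col (- (Q * transpose_mat B * Q))"
  then have pq: "p < n" "q < n" using carrier by auto
  obtain i a where i: "i < k" "a < ns i" "p = (\<Sum>l<i. ns l) + a"
    using block_index_cases[of p ns k] pq n by auto
  obtain j b where j: "j < k" "b < ns j" "q = (\<Sum>l<j. ns l) + b"
    using block_index_cases[of q ns k] pq n by auto
  have "(Q * transpose_mat B * Q) $$ (p, q) = (\<Sum>v<n. (\<Sum>u<n. Q $$ (p, u) * B $$ (v, u)) * Q $$ (v, q))"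
    using carrier B pq by (simp add: scalar_prod_def lessThan_atLeast0 del: assoc_mult_mat)
  also have "\<dots> = (\<Sum>d<ns j. (\<Sum>c<ns i. Qs i $$ (a, c)
      * B $$ ((\<Sum>l<j. ns l) + d, (\<Sum>l<i. ns l) + c)) * Qs j $$ (d, b))"
    using i j by (simp add: diag_block_mat_row_sum diag_block_mat_col_sum)
  also have "\<dots> = (Qs i * transpose_mat (mat_block ns B j i) * Qs j) $$ (a, b)"
    using Qs[OF i(1)] Qs[OF j(1)] i j
    by (simp add: scalar_prod_def lessThan_atLeast0 mat_block_def del: assoc_mult_mat)
  also have "\<dots> = - mat_block ns B i j $$ (a, b)"
    using Qs[OF i(1)] Qs[OF j(1)] i j
    by (subst blocks[OF i(1) j(1)]) (simp del: assoc_mult_mat index_mult_mat(1))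
  also have "mat_block ns B i j $$ (a, b) = B $$ (p, q)"
    using i j by (simp add: mat_block_def)
  finally show "B $$ (p, q) = (- (Q * transpose_mat B * Q)) $$ (p, q)"
    using carrier pq B by simp
qed

end

section \<open>Transfer from functions to matrices\<close>

lemma superpattern_allows_orthogonality:
  fixes Q B :: "real mat"
  assumes Q: "Q \<in> carrier_mat n n" and B: "B \<in> carrier_mat n n"
    and orth: "Q * transpose_mat Q = 1\<^sub>m n"
    and skew: "B = - (Q * transpose_mat B * Q)"
    and inj: "\<And>X. \<lbrakk>X \<in> carrier_mat n n; transpose_mat X = X;
      hadamard_prod (X * Q) (superpattern_dir (sgn_mat Q) (sgn_mat B)) = 0\<^sub>m n n\<rbrakk> \<Longrightarrow> X = 0\<^sub>m n n"
  shows "allows_orthogonality (superpattern_dir (sgn_mat Q) (sgn_mat B))"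
proof -
  let ?P = "{..<n} \<times> {..<n}"
  let ?T = "superpattern_dir (sgn_mat Q) (sgn_mat B)"
  \<comment> \<open>Extension by zero keeps the support \<open>M\<close> inside the index square,
    whatever \<open>$$\<close> yields out of range.\<close>
  define Qf where "Qf = (\<lambda>p. if p \<in> ?P then Q $$ p else 0)"
  define Bf where "Bf = (\<lambda>p. if p \<in> ?P then B $$ p else 0)"
  define M where "M = {p. Qf p \<noteq> 0 \<or> Bf p \<noteq> 0}"
  have T: "?T $$ (i, j) = (if Qf (i, j) \<noteq> 0 then sgn (Qf (i, j)) else sgn (Bf (i, j)))"
    if "i < n" "j < n" for i j
    using that Q B by (simp add: superpattern_dir_def sgn_mat_def Qf_def Bf_def sgn_zero_iff)
  have mult_entry: "(C * transpose_mat D) $$ (i, j) = (\<Sum>l<n. C $$ (i, l) * D $$ (j, l))"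
    if "C \<in> carrier_mat n n" "D \<in> carrier_mat n n" "i < n" "j < n" for C D :: "real mat" and i j
    using that by (simp add: scalar_prod_def lessThan_atLeast0)
  \<comment> \<open>Multiplying \<open>skew\<close> by the transpose of \<open>Q\<close> on the
    right gives the tangency condition.\<close>
  have BQ: "B * transpose_mat Q = - (Q * transpose_mat B)"
  proof -
    have "B * transpose_mat Q = - (Q * transpose_mat B * Q) * transpose_mat Q"
      by (subst skew) (rule refl)
    also have "\<dots> = - (Q * transpose_mat B * (Q * transpose_mat Q))"
      using Q B by (simp add: assoc_mult_mat[of _ n n _ n _ n])
    also have "\<dots> = - (Q * transpose_mat B)"
      using Q B orth by simp
    finally show ?thesis .
  qed
  obtain A where A: "\<And>p. p \<in> ?P \<Longrightarrow> gram_defect n A p = 0"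
    and sgnA: "\<And>p. sgn (A p) = (if Qf p \<noteq> 0 then sgn (Qf p) else sgn (Bf p))"
  proof (rule orthogonal_perturbation[of M n Qf Bf])
    show "M \<subseteq> ?P"
      by (auto simp: M_def Qf_def Bf_def split: if_splits)
    show "M = {p. Qf p \<noteq> 0 \<or> Bf p \<noteq> 0}"
      by (rule M_def)
    show "gram_defect n Qf p = 0" if "p \<in> ?P" for p
      using that arg_cong[OF orth, of "\<lambda>A. A $$ p"]
      by (auto simp: gram_defect_def Qf_def mult_entry[OF Q Q] simp del: index_mult_mat)
    show "(\<Sum>l<n. Qf (i, l) * Bf (j, l)) + (\<Sum>l<n. Bf (i, l) * Qf (j, l)) = 0"
      if "i < n" "j < n" for i j
    proof -
      have "(B * transpose_mat Q) $$ (i, j) = - (Q * transpose_mat B) $$ (i, j)"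
        using BQ that Q B by simp
      then show ?thesis
        using that by (simp add: mult_entry[OF Q B] mult_entry[OF B Q] Qf_def Bf_def del: index_mult_mat)
    qed
    show "\<forall>p. X p = 0"
      if supp: "\<And>p. p \<notin> ?P \<Longrightarrow> X p = 0" and sym: "\<And>i j. X (i, j) = X (j, i)"
        and zero: "\<And>p. p \<in> ?P \<Longrightarrow> masked_mult n M X Qf p = 0" for X
    proof -
      have "mat n n X = 0\<^sub>m n n"
      proof (rule inj)
        show "transpose_mat (mat n n X) = mat n n X"
          by (rule eq_matI) (auto simp: sym)
        show "hadamard_prod (mat n n X * Q) ?T = 0\<^sub>m n n"
        proof (rule eq_matI)
          fix i j assume "i < dim_row (0\<^sub>m n n)" "j < dim_col (0\<^sub>m n n)"
          then have ij: "i < n" "j < n" by auto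
          have "(mat n n X * Q) $$ (i, j) * ?T $$ (i, j) = 0"
          proof (cases "(i, j) \<in> M")
            case True
            have "(mat n n X * Q) $$ (i, j) = masked_mult n M X Qf (i, j)"
              using True ij Q by (simp add: masked_mult_def scalar_prod_def lessThan_atLeast0 Qf_def)
            then show ?thesis using zero ij by simp
          next
            \<comment> \<open>Off \<open>M\<close> the superpattern entry is 0, so the Hadamard
              product imposes nothing there; this is why the mask is \<open>M\<close>.\<close>
            case False
            then show ?thesis using T[OF ij] by (simp add: M_def)
          qed
          then show "hadamard_prod (mat n n X * Q) ?T $$ (i, j) = 0\<^sub>m n n $$ (i, j)"
            using ij Q by (simp add: hadamard_prod_def del: index_mult_mat(1))
        qed (use Q in \<open>auto simp: hadamard_prod_def\<close>)
      qed simp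
      then have "X (i, j) = 0" if "i < n" "j < n" for i j
        using that by (metis index_mat(1) index_zero_mat(1))
      then have "X p = 0" for p
        using supp[of p] by (cases p) auto
      then show ?thesis ..
    qed
  qed (rule that; blast)
  have "mat n n A * transpose_mat (mat n n A) = 1\<^sub>m n"
  proof (rule eq_matI)
    fix i j assume "i < dim_row (1\<^sub>m n)" "j < dim_col (1\<^sub>m n)"
    then have "i < n" "j < n" by auto
    then show "(mat n n A * transpose_mat (mat n n A)) $$ (i, j) = 1\<^sub>m n $$ (i, j)"
      using A[of "(i, j)"] by (simp add: mult_entry gram_defect_def del: index_mult_mat(1))
  qed auto
  then have "transpose_mat (mat n n A) * mat n n A = 1\<^sub>m n"
    by (rule mat_mult_left_right_inverse[rotated 2]) auto
  then have "real_orthogonal_mat (mat n n A)"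
    by (simp add: real_orthogonal_mat_def)
  moreover have "sgn_mat (mat n n A) = ?T"
  proof (rule eq_matI)
    show "dim_row (sgn_mat (mat n n A)) = dim_row ?T" "dim_col (sgn_mat (mat n n A)) = dim_col ?T"
      using Q by (auto simp: sgn_mat_def superpattern_dir_def)
    fix i j assume "i < dim_row ?T" "j < dim_col ?T"
    then have "i < n" "j < n" using Q by (auto simp: sgn_mat_def superpattern_dir_def)
    then show "sgn_mat (mat n n A) $$ (i, j) = ?T $$ (i, j)"
      unfolding T[OF \<open>i < n\<close> \<open>j < n\<close>] by (simp add: sgnA sgn_mat_def)
  qed
  ultimately show ?thesis
    unfolding allows_orthogonality_def by blast
qed

theorem corollary6p13:
  fixes k n :: nat
    and ns :: "nat \<Rightarrow> nat"
    and Qs :: "nat \<Rightarrow> real mat"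
    and Q B S R :: "real mat"
  assumes "0 < k"
    and "\<forall>i<k. 0 < ns i"
    and "(\<Sum>i<k. ns i) = n"
    and "\<forall>i<k. Qs i \<in> carrier_mat (ns i) (ns i) \<and> real_orthogonal_mat (Qs i)"
    and "Q = diag_block_mat (map Qs [0..<k])"
    and "S = sgn_mat Q"
    and "B \<in> carrier_mat n n"
    and "R = sgn_mat B"
    and "\<forall>i<k. \<forall>j<k.
           mat_block ns B i j = - (Qs i * transpose_mat (mat_block ns B j i) * Qs j)"
    and "\<forall>X \<in> carrier_mat n n. transpose_mat X = X \<longrightarrow>
           hadamard_prod (X * Q) (superpattern_dir S R) = 0\<^sub>m n n \<longrightarrow> X = 0\<^sub>m n n"
  shows "allows_orthogonality (superpattern_dir S R)"
  unfolding \<open>S = _\<close> \<open>R = _\<close>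
proof (rule superpattern_allows_orthogonality)
  have Qs: "\<And>i. i < k \<Longrightarrow> Qs i \<in> carrier_mat (ns i) (ns i)" using assms by blast
  show "Q \<in> carrier_mat n n"
    using diag_block_mat_carrier[of k Qs ns] Qs assms by simp
  show "Q * transpose_mat Q = 1\<^sub>m n"
    by (rule diag_block_mat_orthogonal[OF Qs]) (use assms in auto)
  show "B = - (Q * transpose_mat B * Q)"
    by (rule block_skew_imp_skew[OF Qs]) (use assms in auto)
qed (use assms in auto)

end
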